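(* Let $\mu$ be a non-atomic and locally finite Borel measure on $\mathbb{R}^d$ with $\mu(R)=0$. Suppose that $E$ belongs to $\mathscr{G}_\mu^\theta$ for some $0<\theta\le1$ and that there are $t>0$ and $n_0$ such that $\mu(D)\le2^{-tn}$ for all $D\in\mathscr{D}_n$ with $n\ge n_0$. Then, for any $D\in\mathscr{D}$ with $\mu(D)>0$, \[ \dim_{\mathrm H}(E\cap D)\ge\theta t \] and \[ \dim_{\mathrm H}(E\cap D)\ge\theta\,\sup\{\,s_0:\ \exists\varepsilon>0,\ \forall s\in[t,s_0],\ \theta s-G_\mu(s)>\varepsilon\,\}. \]
   Context: $\dim_{\mathrm H}$ denotes Hausdorff dimension. Fix a point $P=(p_1,\dots,p_d)\in\mathbb{R}^d$. For $n\in\mathbb{Z}$, $\mathscr{D}_n$ is the collection of half-open cubes $\prod_{i=1}^d[p_i+n_i2^{-n},\,p_i+(n_i+1)2^{-n})$ with $n_1,\dots,n_d\in\mathbb{Z}$, and $\mathscr{D}=\bigcup_{n\in\mathbb{Z}}\mathscr{D}_n$ (dyadic cubes). $R=\bigcup_{n\in\mathbb{Z}}\bigcup_{D\in\mathscr{D}_n}\partial D$ is the union of all boundaries of dyadic cubes. For $0<\theta\le1$ and $E\subset\mathbb{R}^d$, $\mathscr{M}_\mu^\theta(E)=\inf\{\sum_k\mu(D_k)^\theta : D_k\in\mathscr{D},\ E\subset\bigcup_kD_k\}$ (infimum over countable covers by dyadic cubes). For $0<\theta\le1$, a set $E\subset\mathbb{R}^d$ belongs to the class $\mathscr{G}_\mu^\theta$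 if $E$ is a $G_\delta$-set and $\mathscr{M}_\mu^\eta(E\cap D)=\mathscr{M}_\mu^\eta(D)$ for every $0<\eta<\theta$ and every $D\in\mathscr{D}$. The upper coarse multifractal spectrum of $\mu$ is \[ G_\mu(s)=\lim_{\varepsilon\to0}\limsup_{r\to0}\frac{\log(N(s+\varepsilon,r)-N(s-\varepsilon,r))}{-\log r}, \] where $N(s,r)$ is the number of cubes $Q=[k_1r,(k_1+1)r)\times\cdots\times[k_dr,(k_d+1)r)$, $k_1,\dots,k_d\in\mathbb{Z}$, with $\mu(Q)\ge r^s$; here $\log0=-\infty$. *)

theory Defs
  imports "HOL-Analysis.Analysis"
begin

subsection \<open>Hausdorff dimension\<close>

text \<open>
  The library has \<open>0 powr 0 = 0\<close>, whereas Hausdorff measure uses \<open>0\<^sup>0 = 1\<close> for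
  non-empty sets; the empty set always contributes 0.
\<close>

definition diam_pow :: "real \<Rightarrow> 'a::metric_space set \<Rightarrow> ennreal" where
  "diam_pow s U = (if U = {} then 0 else if s = 0 then 1 else ennreal (diameter U powr s))"

text \<open>
  Covering sets have to be bounded, since \<^const>\<open>diameter\<close> is unspecified on unbounded sets.
\<close>

definition hausdorff_pre :: "real \<Rightarrow> real \<Rightarrow> 'a::metric_space set \<Rightarrow> ennreal" where
  "hausdorff_pre \<delta> s E =
     (INF U\<in>{U :: nat \<Rightarrow> 'a set. E \<subseteq> (\<Union>k. U k) \<and> (\<forall>k. bounded (U k) \<and> diameter (U k) \<le> \<delta>)}.
        \<Sum>k. diam_pow s (U k))"

definition hausdorff_measure :: "real \<Rightarrow> 'a::metric_space set \<Rightarrow> ennreal" where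
  "hausdorff_measure s E = (SUP \<delta>\<in>{0<..}. hausdorff_pre \<delta> s E)"

definition hausdorff_dim :: "'a::metric_space set \<Rightarrow> ereal" where
  "hausdorff_dim E = (INF s\<in>{s. 0 \<le> s \<and> hausdorff_measure s E = 0}. ereal s)"

subsection \<open>Borel measures\<close>

definition nonatomic :: "'a measure \<Rightarrow> bool" where
  "nonatomic M \<longleftrightarrow>
     \<not> (\<exists>A\<in>sets M. emeasure M A > 0 \<and>
          (\<forall>B\<in>sets M. B \<subseteq> A \<longrightarrow> emeasure M B = 0 \<or> emeasure M B = emeasure M A))"

definition locally_finite :: "'a::topological_space measure \<Rightarrow> bool" where
  "locally_finite M \<longleftrightarrow> (\<forall>x. \<exists>U. open U \<and> x \<in> U \<and> emeasure M U < \<infinity>)"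

subsection \<open>Dyadic cubes\<close>

definition grid_cube :: "real ^ 'n \<Rightarrow> real \<Rightarrow> ('n \<Rightarrow> int) \<Rightarrow> (real ^ 'n) set" where
  "grid_cube p r k =
     {x. \<forall>i. p $ i + of_int (k i) * r \<le> x $ i \<and> x $ i < p $ i + (of_int (k i) + 1) * r}"

definition dyadic_level :: "real ^ 'n \<Rightarrow> int \<Rightarrow> (real ^ 'n) set set" where
  "dyadic_level p n = range (grid_cube p (2 powi (- n)))"

definition dyadic :: "real ^ 'n \<Rightarrow> (real ^ 'n) set set" where
  "dyadic p = (\<Union>n. dyadic_level p n)"

definition dyadic_boundaries :: "real ^ 'n \<Rightarrow> (real ^ 'n) set" where
  "dyadic_boundaries p = (\<Union>n. \<Union>D\<in>dyadic_level p n. frontier D)"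

subsection \<open>The classes $\mathscr{G}_\mu^\theta$\<close>

text \<open>
  Countable covers are sequences whose members may be empty, so that finite covers are included;
  an empty member contributes 0. For a locally finite measure every dyadic cube has finite
  measure, so the real-valued \<^const>\<open>measure\<close> loses nothing.
\<close>

definition net_content :: "real ^ 'n \<Rightarrow> (real ^ 'n) measure \<Rightarrow> real \<Rightarrow> (real ^ 'n) set \<Rightarrow> ennreal" where
  "net_content p M \<theta> E =
     (INF C\<in>{C :: nat \<Rightarrow> (real ^ 'n) set. range C \<subseteq> insert {} (dyadic p) \<and> E \<subseteq> (\<Union>k. C k)}.
        \<Sum>k. ennreal (measure M (C k) powr \<theta>))"

definition large_intersection :: "real ^ 'n \<Rightarrow> (real ^ 'n) measure \<Rightarrow> real \<Rightarrow> (real ^ 'n) set set" where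
  "large_intersection p M \<theta> =
     {E. gdelta_in euclidean E \<and>
         (\<forall>\<eta>. 0 < \<eta> \<and> \<eta> < \<theta> \<longrightarrow>
            (\<forall>D\<in>dyadic p. net_content p M \<eta> (E \<inter> D) = net_content p M \<eta> D))}"

subsection \<open>The upper coarse multifractal spectrum\<close>

definition coarse_count :: "(real ^ 'n) measure \<Rightarrow> real \<Rightarrow> real \<Rightarrow> ennreal" where
  "coarse_count M s r =
     emeasure (count_space UNIV) {Q \<in> range (grid_cube 0 r). emeasure M Q \<ge> ennreal (r powr s)}"

definition eln :: "ennreal \<Rightarrow> ereal" where
  "eln x = (if x = 0 then - \<infinity> else if x = \<infinity> then \<infinity> else ereal (ln (enn2real x)))"

text \<open>
  The counts may be infinite when the measure is infinite. Subtraction on \<^typ>\<open>ennreal\<close>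
  then yields \<open>\<infinity> - \<infinity> = \<infinity>\<close>; for finite counts it is the ordinary difference, because for
  \<open>r < 1\<close> the count is increasing in \<open>s\<close>. The outer limit exists because the inner upper limit
  is increasing in \<open>\<epsilon>\<close>.
\<close>

definition coarse_spectrum :: "(real ^ 'n) measure \<Rightarrow> real \<Rightarrow> ereal" where
  "coarse_spectrum M s =
     Lim (at_right 0) (\<lambda>\<epsilon>. Limsup (at_right 0) (\<lambda>r.
       eln (coarse_count M (s + \<epsilon>) r - coarse_count M (s - \<epsilon>) r) / ereal (- ln r)))"

end

theory Submission
  imports Defs
begin

text \<open>
  Write \<open>M\<^sup>\<eta>\<close> for the net content. It is an outer measure, and for \<open>\<eta> \<le> 1\<close> subadditivity of
  \<open>x \<mapsto> x\<^sup>\<eta>\<close> gives \<open>M\<^sup>\<eta>(D) \<ge> \<mu>(D)\<^sup>\<eta>\<close> (\<open>net_content_ge_measure_powr\<close>). So a set of the class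
  meets a cube \<open>D\<close> of positive measure in a set of positive content for every \<open>\<eta> < \<theta>\<close>.

  Positive content turns into positive Hausdorff measure as follows. Let \<open>\<sigma> > 0\<close> and cover
  \<open>E \<inter> D\<close> by sets \<open>U\<^sub>k\<close> of small diameter. Each \<open>U\<^sub>k\<close> lies in boundedly many dyadic cubes
  of side \<open>r\<^sub>k\<close> comparable to its diameter. Cubes of side \<open>r\<close> with measure at most \<open>r\<^sup>\<sigma>\<close> contribute at most
  \<open>r\<^sup>\<sigma>\<^sup>\<eta>\<close> each, so their total is at most a constant times the sum of the
  \<open>\<sigma>\<eta>\<close>-th powers of the diameters. The other cubes, called heavy below, are dealt with all at once,
  without regard to the cover: if the contents of the unions of heavy cubes of level \<open>n\<close> are summable in
  \<open>n\<close>, their tail from a high level on is less than half of \<open>\<mu>(D)\<^sup>\<eta>\<close>, and the sets \<open>U\<^sub>k\<close> have to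
  account for the rest. Hence the \<open>\<sigma>\<eta>\<close>-dimensional measure is positive
  (\<open>hausdorff_measure_nonzero\<close>), and letting \<open>\<eta>\<close> tend to \<open>\<theta>\<close> gives dimension at least
  \<open>\<theta>\<sigma>\<close> (\<open>hausdorff_dim_ge_of_heavy_decay\<close>).

  For \<open>\<sigma> = t\<close> the decay hypothesis leaves no heavy cubes of high level, which is the first bound.
  For \<open>\<sigma> = s\<^sub>0 \<ge> t\<close> with a spectral gap \<open>\<theta> s - G(s) > \<epsilon>\<close> on \<open>[t, s\<^sub>0]\<close>, the heavy cubes have
  measure about \<open>r\<^sup>s\<close> with \<open>s \<in> [t, s\<^sub>0]\<close>, and there are at most \<open>r\<close> to the power
  \<open>-(\<theta> s - \<epsilon>)\<close> of them near each \<open>s\<close>. By compactness finitely many exponents suffice, and for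
  \<open>\<eta>\<close> close to \<open>\<theta>\<close> the total content at scale \<open>r\<close> is at most a constant times
  \<open>r\<^sup>\<epsilon>\<^sup>/\<^sup>2\<close>, which is summable over \<open>r = 2\<^sup>-\<^sup>n\<close> (\<open>heavy_region_net_content_le\<close>).

  The spectrum counts cubes of the grid based at the origin, the content uses the grid based at \<open>P\<close>.
  Since a cube of one grid is covered by boundedly many cubes of the other, passing between them costs
  a constant factor in measure, which is absorbed by slightly enlarging the bands of exponents.
\<close>

section \<open>The net content as an outer measure\<close>

lemma net_content_mono: "A \<subseteq> B \<Longrightarrow> net_content p M \<eta> A \<le> net_content p M \<eta> B"
  unfolding net_content_def by (rule INF_superset_mono) auto

lemma net_content_empty [simp]: "net_content p M \<eta> {} = 0"
proof -
  have "net_content p M \<eta> {} \<le> (\<Sum>k::nat. ennreal (measure M {} powr \<eta>))"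
    unfolding net_content_def by (rule INF_lower2[where i = "\<lambda>_. {}"]) auto
  then show ?thesis by simp
qed

lemma net_content_dyadic_le:
  assumes "Q \<in> dyadic p"
  shows "net_content p M \<eta> Q \<le> ennreal (measure M Q powr \<eta>)"
proof -
  let ?C = "\<lambda>k::nat. if k = 0 then Q else {}"
  have "net_content p M \<eta> Q \<le> (\<Sum>k. ennreal (measure M (?C k) powr \<eta>))"
    unfolding net_content_def using assms by (intro INF_lower) auto
  also have "\<dots> = ennreal (measure M Q powr \<eta>)"
    by (subst suminf_finite[of "{0}"]) auto
  finally show ?thesis .
qed

text \<open>
  Near-optimal covers of the pieces, with errors \<open>e/2, e/4, \<dots>\<close>, are merged into one sequence.
\<close>

lemma net_content_countable_subadditive:
  "net_content p M \<eta> (\<Union>i::nat. A i) \<le> (\<Sum>i. net_content p M \<eta> (A i))"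
proof (rule ennreal_le_epsilon)
  fix e :: real
  assume fin: "(\<Sum>i. net_content p M \<eta> (A i)) < top" and "0 < e"
  have "\<exists>C. range C \<subseteq> insert {} (dyadic p) \<and> A i \<subseteq> (\<Union>k. C k) \<and>
      (\<Sum>k::nat. ennreal (measure M (C k) powr \<eta>)) \<le> net_content p M \<eta> (A i) + ennreal (e * (1/2) ^ Suc i)" for i
  proof -
    have "net_content p M \<eta> (A i) < top"
      using fin by (metis ennreal_suminf_lessD)
    then have "net_content p M \<eta> (A i) < net_content p M \<eta> (A i) + ennreal (e * (1/2) ^ Suc i)"
      using \<open>0 < e\<close> by (simp add: ennreal_add_left_cancel_less[of _ 0, simplified])
    then show ?thesis
      unfolding net_content_def[of p M \<eta> "A i"] INF_less_iff
      by (auto intro: less_imp_le)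
  qed
  then obtain C where C: "\<And>i. range (C i) \<subseteq> insert {} (dyadic p)" "\<And>i. A i \<subseteq> (\<Union>k. C i k)"
    "\<And>i. (\<Sum>k::nat. ennreal (measure M (C i k) powr \<eta>)) \<le> net_content p M \<eta> (A i) + ennreal (e * (1/2) ^ Suc i)"
    by metis
  let ?B = "\<lambda>m. case prod_decode m of (i, k) \<Rightarrow> C i k"
  have "(\<Union>i. A i) \<subseteq> (\<Union>m. ?B m)"
  proof
    fix x assume "x \<in> (\<Union>i. A i)"
    then obtain i k where "x \<in> C i k" using C(2) by blast
    then show "x \<in> (\<Union>m. ?B m)"
      by (intro UN_I[of "prod_encode (i, k)"]) simp_all
  qed
  moreover have "range ?B \<subseteq> insert {} (dyadic p)"
  proof (rule image_subsetI)
    fix m :: nat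
    show "?B m \<in> insert {} (dyadic p)"
      using C(1) by (cases "prod_decode m") (simp add: image_subset_iff)
  qed
  ultimately have "net_content p M \<eta> (\<Union>i. A i) \<le> (\<Sum>m. ennreal (measure M (?B m) powr \<eta>))"
    unfolding net_content_def by (intro INF_lower) auto
  also have "\<dots> = (\<Sum>m. (\<lambda>(i, k). ennreal (measure M (C i k) powr \<eta>)) (prod_decode m))"
    by (auto intro!: arg_cong[where f = suminf] split: prod.split)
  also have "\<dots> = (\<Sum>i k. ennreal (measure M (C i k) powr \<eta>))"
    by (intro suminf_ennreal_2dimen) auto
  also have "\<dots> \<le> (\<Sum>i. net_content p M \<eta> (A i) + ennreal (e * (1/2) ^ Suc i))"
    by (intro suminf_le C(3)) auto
  also have "\<dots> = (\<Sum>i. net_content p M \<eta> (A i)) + (\<Sum>i. ennreal (e * (1/2) ^ Suc i))"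
    by (intro suminf_add[symmetric]) auto
  also have "(\<Sum>i. ennreal (e * (1/2) ^ Suc i)) = ennreal e"
    using sums_mult[OF power_half_series, of e] \<open>0 < e\<close>
    by (simp add: suminf_ennreal2 sums_iff)
  finally show "net_content p M \<eta> (\<Union>i. A i) \<le> (\<Sum>i. net_content p M \<eta> (A i)) + ennreal e" .
qed

lemma net_content_Un_le:
  "net_content p M \<eta> (A \<union> B) \<le> net_content p M \<eta> A + net_content p M \<eta> B"
proof -
  let ?S = "\<lambda>i::nat. if i = 0 then A else if i = 1 then B else {}"
  have "A \<union> B = (\<Union>i. ?S i)" by (auto split: if_splits)
  then have "net_content p M \<eta> (A \<union> B) \<le> (\<Sum>i. net_content p M \<eta> (?S i))"
    by (simp only: net_content_countable_subadditive)
  also have "\<dots> = net_content p M \<eta> A + net_content p M \<eta> B"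
    by (subst suminf_finite[of "{0,1}"]) auto
  finally show ?thesis .
qed

lemma net_content_finite_UN_le:
  assumes "finite I"
  shows "net_content p M \<eta> (\<Union>i\<in>I. A i) \<le> (\<Sum>i\<in>I. net_content p M \<eta> (A i))"
  using assms
proof induction
  case (insert i I)
  have "net_content p M \<eta> (\<Union>j\<in>insert i I. A j)
      \<le> net_content p M \<eta> (A i) + net_content p M \<eta> (\<Union>j\<in>I. A j)"
    using net_content_Un_le by simp
  also have "\<dots> \<le> (\<Sum>j\<in>insert i I. net_content p M \<eta> (A j))"
    using insert by (simp add: add_left_mono)
  finally show ?case .
qed simp

section \<open>Grid cubes and locally finite measures\<close>

lemma grid_cube_borel [measurable]: "grid_cube p r k \<in> sets borel"
proof -
  have "grid_cube p r k = (\<Inter>i\<in>UNIV. {x. p $ i + of_int (k i) * r \<le> x $ i} \<inter> {x. x $ i < p $ i + (of_int (k i) + 1) * r})"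
    unfolding grid_cube_def by auto
  also have "\<dots> \<in> sets borel"
    by (intro sets.finite_INT sets.Int borel_closed borel_open closed_Collect_le open_Collect_less continuous_intros) auto
  finally show ?thesis .
qed

lemma bounded_grid_cube: "bounded (grid_cube p r k)"
proof (rule bounded_subset[OF bounded_cbox])
  show "grid_cube p r k \<subseteq> cbox (\<chi> i. p $ i + of_int (k i) * r) (\<chi> i. p $ i + (of_int (k i) + 1) * r)"
    unfolding grid_cube_def by (auto simp: mem_box_cart less_imp_le)
qed

text \<open>
  The closure of a bounded set is compact, hence covered by finitely many open sets of finite measure.
\<close>

lemma locally_finite_bounded:
  fixes M :: "'a::euclidean_space measure"
  assumes "sets M = sets borel" "locally_finite M" "bounded A"
  shows "emeasure M A < \<infinity>"
proof -
  have cpt: "compact (closure A)" using assms(3) by simp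
  have "\<forall>x. \<exists>U. open U \<and> x \<in> U \<and> emeasure M U < \<infinity>"
    using assms(2) unfolding locally_finite_def .
  then obtain U where U: "\<And>x. open (U x)" "\<And>x. x \<in> U x" "\<And>x. emeasure M (U x) < \<infinity>"
    by metis
  have "closure A \<subseteq> (\<Union>x\<in>closure A. U x)" using U(2) by blast
  then obtain F where F: "finite F" "closure A \<subseteq> (\<Union>x\<in>F. U x)"
    using compactE_image[OF cpt, of "closure A" U] U(1) by metis
  have "A \<subseteq> (\<Union>x\<in>F. U x)" using F(2) closure_subset by blast
  then have "emeasure M A \<le> emeasure M (\<Union>x\<in>F. U x)"
    using U(1) assms(1) F(1) by (intro emeasure_mono) (auto intro!: sets.finite_UN)
  also have "\<dots> \<le> (\<Sum>x\<in>F. emeasure M (U x))"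
    using U(1) assms(1) F(1) by (intro emeasure_subadditive_finite) auto
  also have "\<dots> < \<infinity>"
    using U(3) F(1) by (simp add: ennreal_sum_less_top less_top)
  finally show ?thesis .
qed

lemma emeasure_grid_cube:
  assumes "sets M = sets borel" "locally_finite M"
  shows "emeasure M (grid_cube p r k) = ennreal (measure M (grid_cube p r k))"
  using locally_finite_bounded[OF assms bounded_grid_cube, of p r k]
  by (intro emeasure_eq_ennreal_measure) auto

lemma dyadic_level_nat: "dyadic_level p (int n) = range (grid_cube p ((1/2) ^ n))"
  unfolding dyadic_level_def by (simp add: power_int_minus power_one_over field_simps)

lemma grid_cube_dyadic: "grid_cube p ((1/2) ^ n) k \<in> dyadic p"
  unfolding dyadic_def using dyadic_level_nat[of p n] by blast

lemma dyadicE: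
  assumes "Q \<in> dyadic p"
  obtains r k where "Q = grid_cube p r k"
  using assms unfolding dyadic_def dyadic_level_def by blast

text \<open>
  Put \<open>m = \<mu>(A)\<close>. For a covering cube \<open>C\<close> the number \<open>x = \<mu>(A \<inter> C)\<close> is at most \<open>m\<close>, so
  \<open>\<mu>(C)\<^sup>\<eta> \<ge> x\<^sup>\<eta> \<ge> x m\<^sup>\<eta>\<^sup>-\<^sup>1\<close> because \<open>\<eta> - 1 \<le> 0\<close>. The pieces \<open>A \<inter> C\<close> have total
  measure at least \<open>m\<close>, and \<open>m m\<^sup>\<eta>\<^sup>-\<^sup>1 = m\<^sup>\<eta>\<close>.
\<close>

lemma net_content_ge_measure_powr:
  fixes M :: "(real ^ 'n) measure"
  assumes borel: "sets M = sets borel" and lf: "locally_finite M"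
    and \<eta>: "0 < \<eta>" "\<eta> \<le> 1" and A: "A \<in> sets borel" "emeasure M A < \<infinity>"
  shows "ennreal (measure M A powr \<eta>) \<le> net_content p M \<eta> A"
proof (cases "measure M A = 0")
  case False
  define m where "m = measure M A"
  have m: "m > 0" using False by (simp add: m_def order_less_le)
  show ?thesis unfolding net_content_def
  proof (rule INF_greatest, clarify)
    fix C :: "nat \<Rightarrow> (real ^ 'n) set"
    assume C: "range C \<subseteq> insert {} (dyadic p)" "A \<subseteq> (\<Union>k. C k)"
    have C_sets: "C k \<in> sets M" for k
    proof -
      have "C k = {} \<or> C k \<in> dyadic p" using C(1) by blast
      then show ?thesis using borel by (auto elim!: dyadicE)
    qed
    have C_fin: "emeasure M (C k) < \<infinity>" for k
    proof -
      have "C k = {} \<or> C k \<in> dyadic p" using C(1) by blast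
      then have "bounded (C k)" by (auto elim!: dyadicE simp: bounded_grid_cube)
      then show ?thesis by (rule locally_finite_bounded[OF borel lf])
    qed
    have A_sets: "A \<in> sets M" using A borel by simp
    have A_fin: "emeasure M A \<noteq> \<infinity>" using A by simp
    have piece: "emeasure M (A \<inter> C k) * ennreal (m powr (\<eta> - 1)) \<le> ennreal (measure M (C k) powr \<eta>)" for k
    proof -
      define x where "x = measure M (A \<inter> C k)"
      have "emeasure M (A \<inter> C k) \<le> emeasure M A"
        using A_sets by (intro emeasure_mono) auto
      then have ex: "emeasure M (A \<inter> C k) = ennreal x"
        unfolding x_def using A(2) by (intro emeasure_eq_ennreal_measure) (auto simp: top_unique)
      have "x \<le> m" unfolding x_def m_def
        using A_sets A_fin C_sets by (intro measure_mono_fmeasurable) (auto simp: fmeasurable_def less_top)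
      have "x \<le> measure M (C k)" unfolding x_def
        using A_sets C_fin C_sets by (intro measure_mono_fmeasurable) (auto simp: fmeasurable_def less_top)
      have "x * m powr (\<eta> - 1) \<le> measure M (C k) powr \<eta>"
      proof (cases "x = 0")
        case False
        then have x: "x > 0" by (simp add: x_def order_less_le)
        have "x * m powr (\<eta> - 1) \<le> x * x powr (\<eta> - 1)"
          using x \<open>x \<le> m\<close> \<eta> by (intro mult_left_mono powr_mono2') auto
        also have "\<dots> = x powr \<eta>" using x by (simp add: powr_mult_base)
        also have "\<dots> \<le> measure M (C k) powr \<eta>"
          using x \<open>x \<le> measure M (C k)\<close> \<eta> by (intro powr_mono2) auto
        finally show ?thesis .
      qed simp
      then show ?thesis
        unfolding ex by (simp flip: ennreal_mult'' add: ennreal_leI)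
    qed
    have "emeasure M A \<le> emeasure M (\<Union>k. A \<inter> C k)"
      using C(2) A_sets C_sets by (intro emeasure_mono) auto
    also have "\<dots> \<le> (\<Sum>k. emeasure M (A \<inter> C k))"
      using A_sets C_sets by (intro emeasure_subadditive_countably) auto
    finally have "ennreal m \<le> (\<Sum>k. emeasure M (A \<inter> C k))"
      using A_fin by (simp add: m_def emeasure_eq_ennreal_measure)
    then have "ennreal m * ennreal (m powr (\<eta> - 1)) \<le> (\<Sum>k. emeasure M (A \<inter> C k)) * ennreal (m powr (\<eta> - 1))"
      by (rule mult_right_mono) simp
    also have "\<dots> = (\<Sum>k. emeasure M (A \<inter> C k) * ennreal (m powr (\<eta> - 1)))"
      by simp
    also have "\<dots> \<le> (\<Sum>k. ennreal (measure M (C k) powr \<eta>))"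
      by (intro suminf_le piece) auto
    finally show "ennreal (measure M A powr \<eta>) \<le> (\<Sum>k. ennreal (measure M (C k) powr \<eta>))"
      using m by (simp flip: ennreal_mult'' m_def add: powr_mult_base)
  qed
qed simp

section \<open>Neighbouring cubes and shifted grids\<close>

definition neighbour_steps :: "('n::finite \<Rightarrow> int) set" where
  "neighbour_steps = PiE UNIV (\<lambda>_. {-1..1})"

lemma neighbour_steps_iff: "j \<in> neighbour_steps \<longleftrightarrow> (\<forall>i. -1 \<le> j i \<and> j i \<le> 1)"
  by (auto simp: neighbour_steps_def PiE_def)

lemma finite_neighbour_steps [simp]: "finite neighbour_steps"
  unfolding neighbour_steps_def by (rule finite_PiE) auto

lemma card_neighbour_steps_ge_1: "1 \<le> card neighbour_steps"
proof -
  have "(\<lambda>_. 0) \<in> neighbour_steps" by (simp add: neighbour_steps_iff)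
  then show ?thesis by (metis One_nat_def Suc_leI card_gt_0_iff empty_iff finite_neighbour_steps)
qed

lemma mem_grid_cube_iff:
  assumes "0 < r"
  shows "x \<in> grid_cube p r k \<longleftrightarrow> (\<forall>i. k i = \<lfloor>(x $ i - p $ i) / r\<rfloor>)"
proof -
  have "(p $ i + of_int (k i) * r \<le> x $ i \<and> x $ i < p $ i + (of_int (k i) + 1) * r)
      \<longleftrightarrow> k i = \<lfloor>(x $ i - p $ i) / r\<rfloor>" for i
    using assms by (auto simp: floor_eq_iff eq_commute[of "k i"] field_simps)
  then show ?thesis by (simp add: grid_cube_def)
qed

lemma inj_grid_cube:
  assumes "0 < r"
  shows "inj (grid_cube p r)"
proof (rule injI)
  fix k l assume eq: "grid_cube p r k = grid_cube p r l"
  have "(\<chi> i. p $ i + of_int (k i) * r) \<in> grid_cube p r k"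
    using assms by (simp add: mem_grid_cube_iff)
  then have "(\<chi> i. p $ i + of_int (k i) * r) \<in> grid_cube p r l" by (simp only: eq)
  then show "k = l" using assms by (auto simp add: mem_grid_cube_iff)
qed

lemma floor_diff_le_1:
  fixes a b :: real
  assumes "\<bar>a - b\<bar> \<le> 1"
  shows "-1 \<le> \<lfloor>a\<rfloor> - \<lfloor>b\<rfloor>" "\<lfloor>a\<rfloor> - \<lfloor>b\<rfloor> \<le> 1"
  using assms by linarith+

text \<open>
  Points whose coordinates differ by at most the side length have cube indices that differ by at
  most 1 in each coordinate.
\<close>

lemma small_set_subset_neighbours:
  assumes "0 < r" "\<And>x y i. x \<in> U \<Longrightarrow> y \<in> U \<Longrightarrow> \<bar>x $ i - y $ i\<bar> \<le> r"
  shows "\<exists>k. U \<subseteq> (\<Union>j\<in>neighbour_steps. grid_cube p r (\<lambda>i. k i + j i))"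
proof (cases "U = {}")
  case False
  then obtain x where x: "x \<in> U" by blast
  define k where "k i = \<lfloor>(x $ i - p $ i) / r\<rfloor>" for i
  have "y \<in> (\<Union>j\<in>neighbour_steps. grid_cube p r (\<lambda>i. k i + j i))" if "y \<in> U" for y
  proof
    let ?j = "\<lambda>i. \<lfloor>(y $ i - p $ i) / r\<rfloor> - k i"
    show "y \<in> grid_cube p r (\<lambda>i. k i + ?j i)"
      using assms(1) by (simp add: mem_grid_cube_iff)
    have "\<bar>(y $ i - p $ i) / r - (x $ i - p $ i) / r\<bar> \<le> 1" for i
      using assms(1) assms(2)[OF that x, of i] by (simp flip: diff_divide_distrib)
    then show "?j \<in> neighbour_steps"
      unfolding neighbour_steps_iff k_def using floor_diff_le_1 by blast
  qed
  then show ?thesis by blast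
qed simp

text \<open>
  The shift \<open>c\<close> of the indices is the same for all cubes. This is what later makes the
  passage to the other grid injective, so that counts carry over.
\<close>

lemma grid_cube_subset_other_grid:
  assumes "0 < r"
  shows "\<exists>c. \<forall>k. grid_cube p r k \<subseteq> (\<Union>j\<in>neighbour_steps. grid_cube q r (\<lambda>i. k i + c i + j i))"
proof -
  define c where "c i = \<lfloor>(p $ i - q $ i) / r\<rfloor>" for i
  have "x \<in> (\<Union>j\<in>neighbour_steps. grid_cube q r (\<lambda>i. k i + c i + j i))"
    if x: "x \<in> grid_cube p r k" for x k
  proof
    let ?j = "\<lambda>i. \<lfloor>(x $ i - q $ i) / r\<rfloor> - (k i + c i)"
    show "x \<in> grid_cube q r (\<lambda>i. k i + c i + ?j i)"
      using assms by (simp add: mem_grid_cube_iff)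
    have "(x $ i - q $ i) / r = (x $ i - p $ i) / r + (p $ i - q $ i) / r" for i
      by (simp flip: add_divide_distrib)
    moreover have "k i = \<lfloor>(x $ i - p $ i) / r\<rfloor>" for i
      using x assms by (simp add: mem_grid_cube_iff)
    ultimately show "?j \<in> neighbour_steps"
      unfolding neighbour_steps_iff c_def by (smt (verit) floor_add)
  qed
  then show ?thesis by blast
qed

section \<open>From net content to Hausdorff measure\<close>

text \<open>
  The threshold is strict, so that no cube is heavy when all measures are bounded by \<open>r\<^sup>a\<close>.
\<close>

definition heavy_region :: "real ^ 'n \<Rightarrow> (real ^ 'n) measure \<Rightarrow> real \<Rightarrow> real \<Rightarrow> (real ^ 'n) set" where
  "heavy_region p M a r = (\<Union>k\<in>{k. r powr a < measure M (grid_cube p r k)}. grid_cube p r k)"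

text \<open>
  A dyadic scale comparable to a given diameter. The additive error serves the sets of diameter zero,
  for which no comparable scale exists.
\<close>

lemma exists_dyadic_scale:
  fixes d s e :: real
  assumes "0 \<le> d" "d \<le> (1/2) ^ N" "0 < s" "0 < e"
  shows "\<exists>n\<ge>N. d \<le> (1/2) ^ n \<and> ((1/2) ^ n) powr s \<le> 2 powr s * d powr s + e"
proof (cases "d = 0")
  case True
  have "(\<lambda>n. ((1/2) powr s) ^ n) \<longlonglongrightarrow> 0"
    using powr_less_mono'[of "1/2" 0 s] \<open>0 < s\<close> by (intro LIMSEQ_power_zero) auto
  then have "\<forall>\<^sub>F n in sequentially. ((1/2) powr s) ^ n < e"
    using \<open>0 < e\<close> by (rule order_tendstoD)
  then obtain n0 where n0: "\<And>n. n \<ge> n0 \<Longrightarrow> ((1/2) powr s) ^ n < e"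
    by (auto simp: eventually_sequentially)
  have "((1/2) ^ max N n0) powr s < e"
    using n0[of "max N n0"] by (simp add: powr_power powr_powr mult.commute flip: powr_realpow)
  then show ?thesis
    using True \<open>0 < s\<close> by (intro exI[of _ "max N n0"]) auto
next
  case False
  then have d: "d > 0" using assms(1) by simp
  then obtain m0 where m0: "(1/2) ^ m0 < d"
    using real_arch_pow_inv[of d "1/2"] by auto
  define m where "m = (LEAST m. (1/2) ^ m < d)"
  have m: "(1/2) ^ m < d" unfolding m_def using m0 by (rule LeastI)
  have "m > N"
  proof (rule ccontr)
    assume "\<not> N < m"
    then have "(1/2::real) ^ N \<le> (1/2) ^ m" by (intro power_decreasing) auto
    then show False using m assms(2) by linarith
  qed
  then obtain n where n: "m = Suc n" "n \<ge> N" by (cases m) auto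
  have "\<not> (1/2) ^ n < d" using not_less_Least[of n "\<lambda>m. (1/2) ^ m < d"] n by (simp add: m_def)
  moreover have "((1/2) ^ n) powr s \<le> (2 * d) powr s"
    using m n \<open>0 < s\<close> by (intro powr_mono2) auto
  ultimately show ?thesis
    using n d \<open>0 < e\<close> by (intro exI[of _ n]) (auto simp: powr_mult)
qed

text \<open>
  Outside the heavy cubes, \<open>U\<close> is covered by those of its neighbouring cubes of side \<open>r\<close> that have
  measure at most \<open>r\<^sup>a\<close>.
\<close>

lemma net_content_light_part_le:
  fixes U :: "(real ^ 'n) set"
  assumes "r = (1/2) ^ n" "0 < \<eta>"
    and "\<And>x y i. x \<in> U \<Longrightarrow> y \<in> U \<Longrightarrow> \<bar>x $ i - y $ i\<bar> \<le> r"
  shows "net_content p M \<eta> (U - heavy_region p M a r)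
    \<le> ennreal (real (card (neighbour_steps :: ('n \<Rightarrow> int) set)) * r powr (a * \<eta>))"
proof -
  have r: "0 < r" using assms(1) by simp
  obtain k where k: "U \<subseteq> (\<Union>j\<in>neighbour_steps. grid_cube p r (\<lambda>i. k i + j i))"
    using small_set_subset_neighbours[OF r, of U p] assms(3) by blast
  let ?Q = "\<lambda>j. grid_cube p r (\<lambda>i. k i + j i)"
  let ?J = "{j \<in> neighbour_steps. measure M (?Q j) \<le> r powr a}"
  have "U - heavy_region p M a r \<subseteq> (\<Union>j\<in>?J. ?Q j)"
    using k unfolding heavy_region_def by (force simp: not_less)
  then have "net_content p M \<eta> (U - heavy_region p M a r) \<le> net_content p M \<eta> (\<Union>j\<in>?J. ?Q j)"
    by (rule net_content_mono)
  also have "\<dots> \<le> (\<Sum>j\<in>?J. net_content p M \<eta> (?Q j))"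
    by (intro net_content_finite_UN_le) auto
  also have "\<dots> \<le> (\<Sum>j\<in>?J. ennreal (r powr (a * \<eta>)))"
  proof (rule sum_mono)
    fix j assume j: "j \<in> ?J"
    have "net_content p M \<eta> (?Q j) \<le> ennreal (measure M (?Q j) powr \<eta>)"
      unfolding assms(1) by (intro net_content_dyadic_le grid_cube_dyadic)
    also have "\<dots> \<le> ennreal ((r powr a) powr \<eta>)"
      using j assms(2) by (intro ennreal_leI powr_mono2) auto
    finally show "net_content p M \<eta> (?Q j) \<le> ennreal (r powr (a * \<eta>))"
      by (simp add: powr_powr)
  qed
  also have "\<dots> = ennreal (real (card ?J) * r powr (a * \<eta>))"
    by (simp add: ennreal_mult'' ennreal_of_nat_eq_real_of_nat)
  also have "\<dots> \<le> ennreal (real (card (neighbour_steps :: ('n \<Rightarrow> int) set)) * r powr (a * \<eta>))"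
    by (intro ennreal_leI mult_right_mono) (auto intro: card_mono)
  finally show ?thesis .
qed

text \<open>
  A set of content at least \<open>w\<close> would, if its Hausdorff measure vanished, have a cover with
  arbitrarily small sum. The heavy cubes of level at least \<open>N\<close> account for less than \<open>w/2\<close>,
  and what they leave uncovered has content at most a constant times that sum.
\<close>

lemma hausdorff_measure_nonzero:
  fixes A :: "(real ^ 'n) set"
  assumes w: "0 < w" "ennreal w \<le> net_content p M \<eta> A"
    and "0 < a" "0 < \<eta>"
    and heavy: "\<And>n. n \<ge> N0 \<Longrightarrow> net_content p M \<eta> (heavy_region p M a ((1/2) ^ n)) \<le> ennreal (b n)"
    and b: "\<And>n. 0 \<le> b n" "summable b"
  shows "hausdorff_measure (a * \<eta>) A \<noteq> 0"
proof
  define s where "s = a * \<eta>"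
  define c where "c = real (card (neighbour_steps :: ('n \<Rightarrow> int) set))"
  \<comment> \<open>The light parts will have total content at most \<open>c (2\<^sup>s + 1) e\<close>, which is \<open>w/4\<close>.\<close>
  define e where "e = w / (4 * c * (2 powr s + 1))"
  assume zero: "hausdorff_measure (a * \<eta>) A = 0"
  have s: "0 < s" using assms by (simp add: s_def)
  have c: "1 \<le> c" unfolding c_def using card_neighbour_steps_ge_1 by simp
  have e: "0 < e" unfolding e_def using w(1) c by (intro divide_pos_pos mult_pos_pos add_pos_pos) auto
  obtain N1 where N1: "\<And>n. n \<ge> N1 \<Longrightarrow> \<bar>\<Sum>i. b (i + n)\<bar> < w / 2"
    using suminf_exist_split[OF _ b(2), of "w / 2"] w(1) by auto
  define N where "N = max N0 N1"
  have "hausdorff_pre ((1/2) ^ N) s A \<le> hausdorff_measure s A"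
    unfolding hausdorff_measure_def by (rule SUP_upper) auto
  then have "hausdorff_pre ((1/2) ^ N) s A < ennreal e"
    using zero e by (simp add: s_def)
  then obtain U where U: "A \<subseteq> (\<Union>k. U k)" "\<And>k. bounded (U k)" "\<And>k. diameter (U k) \<le> (1/2) ^ N"
    and sum_U: "(\<Sum>k::nat. diam_pow s (U k)) < ennreal e"
    unfolding hausdorff_pre_def INF_less_iff by blast
  have "\<exists>n\<ge>N. diameter (U k) \<le> (1/2) ^ n \<and>
      ((1/2) ^ n) powr s \<le> 2 powr s * diameter (U k) powr s + e * (1/2) ^ Suc k" for k
    using U(2,3) e s by (intro exists_dyadic_scale diameter_ge_0) auto
  then obtain n where n: "\<And>k. n k \<ge> N" "\<And>k. diameter (U k) \<le> (1/2) ^ n k"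
    "\<And>k. ((1/2) ^ n k) powr s \<le> 2 powr s * diameter (U k) powr s + e * (1/2) ^ Suc k"
    by metis
  define H where "H = (\<Union>m. heavy_region p M a ((1/2) ^ (m + N)))"
  have H_le: "net_content p M \<eta> H \<le> ennreal (\<Sum>m. b (m + N))"
  proof -
    have "net_content p M \<eta> H \<le> (\<Sum>m. net_content p M \<eta> (heavy_region p M a ((1/2) ^ (m + N))))"
      unfolding H_def by (rule net_content_countable_subadditive)
    also have "\<dots> \<le> (\<Sum>m. ennreal (b (m + N)))"
      by (intro suminf_le heavy) (auto simp: N_def)
    also have "\<dots> = ennreal (\<Sum>m. b (m + N))"
      using b by (intro suminf_ennreal2) auto
    finally show ?thesis .
  qed
  have piece: "net_content p M \<eta> (U k - H)
      \<le> ennreal (c * 2 powr s) * diam_pow s (U k) + ennreal (c * e * (1/2) ^ Suc k)" for k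
  proof (cases "U k = {}")
    case False
    have "heavy_region p M a ((1/2) ^ n k) \<subseteq> H"
      unfolding H_def using n(1)[of k] by (intro subsetI UN_I[of "n k - N"]) auto
    then have "net_content p M \<eta> (U k - H) \<le> net_content p M \<eta> (U k - heavy_region p M a ((1/2) ^ n k))"
      by (intro net_content_mono) blast
    also have "\<dots> \<le> ennreal (c * ((1/2) ^ n k) powr s)"
      unfolding c_def s_def
    proof (rule net_content_light_part_le[OF refl \<open>0 < \<eta>\<close>])
      fix x y i assume xy: "x \<in> U k" "y \<in> U k"
      have "\<bar>x $ i - y $ i\<bar> \<le> dist x y"
        using component_le_norm_cart[of "x - y" i] by (simp add: dist_norm)
      also have "\<dots> \<le> diameter (U k)" by (rule diameter_bounded_bound[OF U(2) xy])
      also have "\<dots> \<le> (1/2) ^ n k" by (rule n(2))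
      finally show "\<bar>x $ i - y $ i\<bar> \<le> (1/2) ^ n k" .
    qed
    also have "\<dots> \<le> ennreal (c * (2 powr s * diameter (U k) powr s + e * (1/2) ^ Suc k))"
      using c n(3) by (intro ennreal_leI mult_left_mono) auto
    also have "\<dots> = ennreal (c * 2 powr s * diameter (U k) powr s) + ennreal (c * e * (1/2) ^ Suc k)"
      using c e by (subst ennreal_plus[symmetric]) (auto simp: algebra_simps)
    also have "ennreal (c * 2 powr s * diameter (U k) powr s) = ennreal (c * 2 powr s) * diam_pow s (U k)"
      using False s by (simp add: diam_pow_def ennreal_mult'')
    finally show ?thesis .
  qed simp
  have geom: "(\<Sum>k. ennreal (c * e * (1/2) ^ Suc k)) = ennreal (c * e)"
    using sums_mult[OF power_half_series, of "c * e"] c e by (simp add: suminf_ennreal2 sums_iff)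
  have "net_content p M \<eta> (\<Union>k. U k - H) \<le> (\<Sum>k. net_content p M \<eta> (U k - H))"
    by (rule net_content_countable_subadditive)
  also have "\<dots> \<le> (\<Sum>k. ennreal (c * 2 powr s) * diam_pow s (U k) + ennreal (c * e * (1/2) ^ Suc k))"
    by (intro suminf_le piece) auto
  also have "\<dots> = ennreal (c * 2 powr s) * (\<Sum>k. diam_pow s (U k)) + ennreal (c * e)"
    unfolding geom[symmetric] by (subst suminf_add[symmetric]) auto
  also have "\<dots> \<le> ennreal (c * 2 powr s) * ennreal e + ennreal (c * e)"
    using sum_U by (intro add_right_mono mult_left_mono) auto
  also have "\<dots> = ennreal (c * (2 powr s + 1) * e)"
    using c e by (simp flip: ennreal_mult ennreal_plus add: algebra_simps)
  finally have light: "net_content p M \<eta> (\<Union>k. U k - H) \<le> ennreal (c * (2 powr s + 1) * e)" .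
  have "A \<subseteq> H \<union> (\<Union>k. U k - H)" using U(1) by blast
  then have "net_content p M \<eta> A \<le> net_content p M \<eta> (H \<union> (\<Union>k. U k - H))"
    by (rule net_content_mono)
  also have "\<dots> \<le> net_content p M \<eta> H + net_content p M \<eta> (\<Union>k. U k - H)"
    by (rule net_content_Un_le)
  also have "\<dots> \<le> ennreal (\<Sum>m. b (m + N)) + ennreal (c * (2 powr s + 1) * e)"
    by (intro add_mono H_le light)
  also have "\<dots> = ennreal ((\<Sum>m. b (m + N)) + c * (2 powr s + 1) * e)"
    using b c e
    by (intro ennreal_plus[symmetric] suminf_nonneg mult_nonneg_nonneg) (auto simp: summable_ignore_initial_segment)
  finally have "ennreal w \<le> ennreal ((\<Sum>m. b (m + N)) + c * (2 powr s + 1) * e)"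
    using w(2) by (rule order_trans[rotated])
  moreover have "(\<Sum>m. b (m + N)) < w / 2" using N1[of N] by (simp add: N_def)
  moreover have "c * (2 powr s + 1) * e = w / 4"
  proof -
    have "c * q * (w / (4 * c * q)) = w / 4" if "q \<noteq> 0" for q
      using c that by simp
    moreover have "2 powr s + 1 \<noteq> 0" using powr_ge_zero[of 2 s] by linarith
    ultimately show ?thesis unfolding e_def by blast
  qed
  ultimately show False using w(1) by (simp add: ennreal_le_iff2)
qed

text \<open>
  Covers by sets of diameter at most 1 suffice, and for these the powers of the diameter decrease as
  the exponent grows; this includes the convention for exponent 0.
\<close>

lemma hausdorff_measure_zero_mono:
  fixes A :: "'a::metric_space set"
  assumes "0 \<le> s" "s \<le> s'" "hausdorff_measure s A = 0"
  shows "hausdorff_measure s' A = 0"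
proof -
  have diam_pow_le: "diam_pow s' U \<le> diam_pow s U" if "bounded U" "diameter U \<le> 1" for U :: "'a set"
  proof -
    have d: "0 \<le> diameter U" by (rule diameter_ge_0[OF that(1)])
    have "diameter U powr s' \<le> diameter U powr s"
      using d that(2) assms(2) by (intro powr_mono') auto
    moreover have "diameter U powr s' \<le> 1"
      using powr_mono2[of s' "diameter U" 1] d that(2) assms(1,2) by simp
    ultimately show ?thesis
      using assms(1,2) by (auto simp: diam_pow_def ennreal_leI ennreal_le_1)
  qed
  have "hausdorff_pre \<delta> s' A = 0" if "0 < \<delta>" for \<delta>
  proof -
    let ?\<delta> = "min \<delta> 1"
    have "hausdorff_pre \<delta> s' A \<le> hausdorff_pre ?\<delta> s' A"
      unfolding hausdorff_pre_def by (rule INF_superset_mono) auto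
    also have "\<dots> \<le> hausdorff_pre ?\<delta> s A"
      unfolding hausdorff_pre_def
      by (intro INF_superset_mono suminf_le diam_pow_le) auto
    also have "\<dots> \<le> hausdorff_measure s A"
      unfolding hausdorff_measure_def using that by (intro SUP_upper) auto
    finally show ?thesis using assms(3) by simp
  qed
  then show ?thesis unfolding hausdorff_measure_def by simp
qed

lemma hausdorff_dim_geI:
  assumes "\<And>y. y < x \<Longrightarrow> \<exists>u>y. hausdorff_measure u A \<noteq> 0"
  shows "ereal x \<le> hausdorff_dim A"
  unfolding hausdorff_dim_def
proof (rule INF_greatest)
  fix s assume s: "s \<in> {s. 0 \<le> s \<and> hausdorff_measure s A = 0}"
  have "\<not> s < x"
  proof
    assume "s < x"
    then obtain u where "u > s" "hausdorff_measure u A \<noteq> 0" using assms by blast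
    then show False using hausdorff_measure_zero_mono[of s u A] s by auto
  qed
  then show "ereal x \<le> ereal s" by simp
qed

section \<open>Counting cubes by the coarse spectrum\<close>

lemma coarse_count_mono:
  assumes "0 < r" "r < 1" "s \<le> s'"
  shows "coarse_count M s r \<le> coarse_count M s' r"
proof -
  have "ennreal (r powr s') \<le> ennreal (r powr s)"
    using assms by (intro ennreal_leI powr_mono') auto
  from order_trans[OF this] show ?thesis
    unfolding coarse_count_def by (intro emeasure_mono subsetI) (simp_all del: ennreal_le_iff2)
qed

lemma eln_mono:
  assumes "x \<le> y"
  shows "eln x \<le> eln y"
proof (cases "x = 0 \<or> y = \<infinity>")
  case False
  have "y \<noteq> 0" "x \<noteq> \<infinity>"
    using False assms by (auto simp: top_unique)
  moreover have "0 < enn2real x" "enn2real x \<le> enn2real y"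
    using False assms \<open>x \<noteq> \<infinity>\<close> by (auto simp: enn2real_positive_iff less_top enn2real_mono not_gr_zero zero_less_iff_neq_zero)
  ultimately show ?thesis using False by (simp add: eln_def)
qed (auto simp: eln_def)

text \<open>
  The quantity whose limit as \<open>e\<close> tends to 0 is the coarse spectrum.
\<close>

definition coarse_exponent :: "(real ^ 'n) measure \<Rightarrow> real \<Rightarrow> real \<Rightarrow> ereal" where
  "coarse_exponent M s e =
     Limsup (at_right 0) (\<lambda>r. eln (coarse_count M (s + e) r - coarse_count M (s - e) r) / ereal (- ln r))"

lemma eventually_at_right_0_less_1: "\<forall>\<^sub>F r in at_right (0::real). 0 < r \<and> r < 1"
  using eventually_at_right_real[of 0 1] by (simp add: greaterThanLessThan_def)

lemma coarse_exponent_mono: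
  assumes "0 \<le> e" "e \<le> e'"
  shows "coarse_exponent M s e \<le> coarse_exponent M s e'"
  unfolding coarse_exponent_def
proof (rule Limsup_mono, use eventually_at_right_0_less_1 in \<open>rule eventually_mono\<close>)
  fix r :: real assume r: "0 < r \<and> r < 1"
  then show "eln (coarse_count M (s + e) r - coarse_count M (s - e) r) / ereal (- ln r)
      \<le> eln (coarse_count M (s + e') r - coarse_count M (s - e') r) / ereal (- ln r)"
    using assms
    by (intro ereal_divide_right_mono eln_mono ennreal_minus_mono coarse_count_mono) auto
qed

text \<open>
  A function that is increasing in \<open>e\<close> has its infimum as right-hand limit.
\<close>

lemma coarse_spectrum_eq_INF:
  "coarse_spectrum M s = (INF e\<in>{0<..}. coarse_exponent M s e)"
proof -
  let ?I = "INF e\<in>{0<..}. coarse_exponent M s e"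
  have "(coarse_exponent M s \<longlongrightarrow> ?I) (at_right 0)"
  proof (rule decreasing_tendsto)
    show "\<forall>\<^sub>F e in at_right 0. ?I \<le> coarse_exponent M s e"
      using eventually_at_right_less[of "0::real"] by eventually_elim (auto intro: INF_lower)
    fix x assume "?I < x"
    then obtain e0 where e0: "0 < e0" "coarse_exponent M s e0 < x"
      by (auto simp: INF_less_iff)
    have "\<forall>\<^sub>F e in at_right 0. e \<in> {0<..<e0}" by (rule eventually_at_right_real[OF e0(1)])
    then show "\<forall>\<^sub>F e in at_right 0. coarse_exponent M s e < x"
    proof eventually_elim
      case (elim e)
      then show ?case using coarse_exponent_mono[of e e0 M s] e0(2) by (auto intro: le_less_trans)
    qed
  qed
  then show ?thesis
    unfolding coarse_spectrum_def coarse_exponent_def[abs_def] by (intro tendsto_Lim) auto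
qed

text \<open>
  The cubes that are counted between the exponents \<open>s - e\<close> and \<open>s + e\<close>, represented by their indices
  so that the two grids can be compared by a shift.
\<close>

definition level_band :: "(real ^ 'n) measure \<Rightarrow> real \<Rightarrow> real \<Rightarrow> real \<Rightarrow> ('n \<Rightarrow> int) set" where
  "level_band M s e r = {k. r powr (s + e) \<le> measure M (grid_cube 0 r k) \<and>
     measure M (grid_cube 0 r k) < r powr (s - e)}"

text \<open>
  If one of the two counts were infinite, so would be the larger one and, as \<open>\<infinity> - \<infinity> = \<infinity>\<close>, also
  the difference. Finite counts are subtracted as cardinalities of nested sets.
\<close>

lemma card_level_band_le_coarse_count:
  fixes M :: "(real ^ 'n) measure"
  assumes M: "sets M = sets borel" "locally_finite M" and r: "0 < r" "r < 1" and e: "0 \<le> e"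
    and fin: "coarse_count M (s + e) r - coarse_count M (s - e) r < top"
  shows "finite (level_band M s e r)"
    and "of_nat (card (level_band M s e r)) \<le> coarse_count M (s + e) r - coarse_count M (s - e) r"
proof -
  define B where "B a = {Q \<in> range (grid_cube (0 :: real ^ 'n) r). emeasure M Q \<ge> ennreal (r powr a)}" for a
  have count: "coarse_count M a r = emeasure (count_space UNIV) (B a)" for a
    by (simp add: coarse_count_def B_def)
  have sub: "B (s - e) \<subseteq> B (s + e)"
  proof -
    have "ennreal (r powr (s + e)) \<le> ennreal (r powr (s - e))"
      using r e by (intro ennreal_leI powr_mono') auto
    from order_trans[OF this] show ?thesis unfolding B_def by blast
  qed
  have big: "finite (B (s + e))"
  proof (rule ccontr)
    assume "infinite (B (s + e))"
    then show False using fin by (cases "finite (B (s - e))") (auto simp: count)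
  qed
  have small: "finite (B (s - e))" using sub big by (rule finite_subset)
  have img: "grid_cube 0 r ` level_band M s e r \<subseteq> B (s + e) - B (s - e)"
    unfolding B_def level_band_def
    by (auto simp: emeasure_grid_cube[OF M] ennreal_leI not_le ennreal_less_iff)
  have inj: "inj_on (grid_cube (0 :: real ^ 'n) r) (level_band M s e r)"
    using inj_grid_cube[OF r(1)] by (rule inj_on_subset) simp
  show "finite (level_band M s e r)"
    using img inj big by (meson finite_Diff finite_imageD finite_subset)
  have "card (level_band M s e r) \<le> card (B (s + e) - B (s - e))"
    using img inj big by (metis card_image card_mono finite_Diff)
  also have "\<dots> = card (B (s + e)) - card (B (s - e))"
    using small sub by (rule card_Diff_subset)
  finally have "of_nat (card (level_band M s e r)) \<le> (of_nat (card (B (s + e)) - card (B (s - e))) :: ennreal)"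
    by simp
  also have "\<dots> = of_nat (card (B (s + e))) - of_nat (card (B (s - e)))"
    by (simp add: ennreal_of_nat_eq_real_of_nat ennreal_minus of_nat_diff card_mono[OF big sub])
  finally show "of_nat (card (level_band M s e r)) \<le> coarse_count M (s + e) r - coarse_count M (s - e) r"
    using small big by (simp add: count)
qed

lemma level_band_card_of_spectrum_less:
  fixes M :: "(real ^ 'n) measure"
  assumes M: "sets M = sets borel" "locally_finite M" and less: "coarse_spectrum M s < ereal x"
  obtains e0 where "0 < e0" and "\<And>e. 0 < e \<Longrightarrow> e \<le> e0 \<Longrightarrow>
    \<forall>\<^sub>F r in at_right 0. finite (level_band M s e r) \<and> real (card (level_band M s e r)) \<le> r powr (- x)"
proof -
  obtain e0 where e0: "0 < e0" "coarse_exponent M s e0 < ereal x"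
    using less unfolding coarse_spectrum_eq_INF INF_less_iff by auto
  show thesis
  proof (rule that[OF e0(1)])
    fix e :: real assume e: "0 < e" "e \<le> e0"
    have "coarse_exponent M s e < ereal x"
      using coarse_exponent_mono[of e e0 M s] e e0(2) by auto
    then have "\<forall>\<^sub>F r in at_right 0.
        eln (coarse_count M (s + e) r - coarse_count M (s - e) r) / ereal (- ln r) < ereal x"
      unfolding coarse_exponent_def by (rule Limsup_lessD)
    then show "\<forall>\<^sub>F r in at_right 0.
        finite (level_band M s e r) \<and> real (card (level_band M s e r)) \<le> r powr (- x)"
      using eventually_at_right_0_less_1
    proof eventually_elim
      case (elim r)
      define N where "N = coarse_count M (s + e) r - coarse_count M (s - e) r"
      have r: "0 < r" "r < 1" and l: "0 < - ln r" using elim by auto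
      have eln: "eln N / ereal (- ln r) < ereal x" using elim by (simp add: N_def)
      then have "N \<noteq> \<infinity>"
        using l by (auto simp: eln_def)
      then have N: "N < top" by (simp add: less_top)
      note band = card_level_band_le_coarse_count[OF M r less_imp_le[OF e(1)] N[unfolded N_def], folded N_def]
      have "real (card (level_band M s e r)) \<le> enn2real N"
        using band(2) N by (metis enn2real_mono enn2real_of_nat)
      also have "enn2real N \<le> r powr (- x)"
      proof (cases "enn2real N = 0")
        case False
        then have "N \<noteq> 0" "0 < enn2real N" by (auto simp: order_less_le)
        then have "ln (enn2real N) / (- ln r) < x"
          using eln \<open>N \<noteq> \<infinity>\<close> l by (simp add: eln_def)
        then have "ln (enn2real N) < - x * ln r"
          using pos_divide_less_eq[OF l] by simp
        then have "exp (ln (enn2real N)) \<le> exp (- x * ln r)" by simp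
        then show ?thesis using r \<open>0 < enn2real N\<close> by (simp add: powr_def)
      qed simp
      finally show ?case using band(1) by blast
    qed
  qed
qed

section \<open>Heavy cubes below a spectral gap\<close>

text \<open>
  If \<open>m = r\<^sup>u\<close> then \<open>u\<close> lies in \<open>[t, s\<^sub>0]\<close> up to an error coming from the factor \<open>c\<close>. The exponents
  are covered by intervals of half the radius, and \<open>c\<close> is at most \<open>r\<close> to the power \<open>-e\<^sub>s/2\<close>; the
  other half of the radius therefore absorbs the error.
\<close>

lemma exists_level_band:
  fixes e :: "real \<Rightarrow> real"
  assumes r: "0 < r" "r < 1" and c: "1 \<le> c" and ts: "t \<le> s0"
    and m: "r powr s0 \<le> c * m" "m \<le> c * r powr t"
    and cover: "{t..s0} \<subseteq> (\<Union>s\<in>S. ball s (e s / 2))"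
    and small: "\<And>s. s \<in> S \<Longrightarrow> c * r powr (e s / 2) \<le> 1"
  shows "\<exists>s\<in>S. r powr (s + e s) \<le> m \<and> m < r powr (s - e s)"
proof -
  have near: "\<exists>s\<in>S. \<bar>u - s\<bar> < e s / 2" if "u \<in> {t..s0}" for u
    using cover that by (fastforce simp: dist_real_def abs_minus_commute)
  have anti: "r powr b \<le> r powr a" if "a \<le> b" for a b
    using r that by (intro powr_mono') auto
  have santi: "r powr b < r powr a" if "a < b" for a b
    using r that by (intro powr_less_mono') auto
  have "0 < c * m" using m(1) r by (smt (verit) powr_gt_zero)
  then have m0: "0 < m" using c by (simp add: zero_less_mult_iff)
  consider "m < r powr s0" | "r powr t < m" | "r powr s0 \<le> m" "m \<le> r powr t" by linarith
  then show ?thesis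
  proof cases
    case 1
    obtain s where s: "s \<in> S" "\<bar>s0 - s\<bar> < e s / 2" using near[of s0] ts by auto
    have "m < r powr (s - e s)" using 1 anti[of "s - e s" s0] s by linarith
    moreover have "r powr (s + e s) \<le> m"
    proof -
      have "r powr (s + e s) \<le> r powr s0 * r powr (e s / 2)"
        unfolding powr_add[symmetric] using s(2) by (intro anti) linarith
      also have "\<dots> \<le> c * m * r powr (e s / 2)"
        using m(1) by (rule mult_right_mono) simp
      also have "\<dots> = m * (c * r powr (e s / 2))" by simp
      also have "\<dots> \<le> m * 1" using small[OF s(1)] m0 by (intro mult_left_mono) auto
      finally show ?thesis by simp
    qed
    ultimately show ?thesis using s(1) by blast
  next
    case 2
    obtain s where s: "s \<in> S" "\<bar>t - s\<bar> < e s / 2" using near[of t] ts by auto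
    have "r powr (s + e s) \<le> m" using 2 anti[of t "s + e s"] s by linarith
    moreover have "m < r powr (s - e s)"
    proof -
      have "m \<le> c * r powr t" by (rule m(2))
      also have "\<dots> = (c * r powr (e s / 2)) * r powr (t - e s / 2)"
        by (simp add: mult.assoc flip: powr_add)
      also have "\<dots> \<le> 1 * r powr (t - e s / 2)"
        using small[OF s(1)] by (rule mult_right_mono) simp
      also have "\<dots> < r powr (s - e s)"
        unfolding mult_1 using s(2) by (intro santi) linarith
      finally show ?thesis .
    qed
    ultimately show ?thesis using s(1) by blast
  next
    case 3
    define u where "u = ln m / ln r"
    have mu: "m = r powr u" using r m0 by (simp add: u_def powr_def)
    have "u \<in> {t..s0}"
      using 3 santi[of s0 u] santi[of u t] unfolding mu by (auto simp: not_le[symmetric])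
    then obtain s where s: "s \<in> S" "\<bar>u - s\<bar> < e s / 2" using near by blast
    have "r powr (s + e s) \<le> m" "m < r powr (s - e s)"
      unfolding mu using s(2) by (intro anti santi; linarith)+
    then show ?thesis using s(1) by blast
  qed
qed

text \<open>
  One of the boundedly many cubes of the other grid that cover a given cube carries at least the
  average share of its measure.
\<close>

lemma grid_measure_comparison:
  fixes M :: "(real ^ 'n) measure"
  assumes M: "sets M = sets borel" "locally_finite M" and "0 < r"
  obtains h where "\<And>k. \<exists>j\<in>neighbour_steps. measure M (grid_cube p r k)
      \<le> real (card (neighbour_steps :: ('n \<Rightarrow> int) set)) * measure M (grid_cube q r (\<lambda>i. k i + h i + j i))"
proof -
  let ?J = "neighbour_steps :: ('n \<Rightarrow> int) set"
  obtain h where h: "\<And>k. grid_cube p r k \<subseteq> (\<Union>j\<in>?J. grid_cube q r (\<lambda>i. k i + h i + j i))"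
    using grid_cube_subset_other_grid[OF \<open>0 < r\<close>, of p q] by blast
  show thesis
  proof
    fix k
    let ?Q = "\<lambda>j. grid_cube q r (\<lambda>i. k i + h i + j i)"
    show "\<exists>j\<in>?J. measure M (grid_cube p r k) \<le> real (card ?J) * measure M (?Q j)"
    proof (rule ccontr)
      assume "\<not> ?thesis"
      then have less: "real (card ?J) * measure M (?Q j) < measure M (grid_cube p r k)" if "j \<in> ?J" for j
        using that by (auto simp: not_le)
      have "emeasure M (\<Union>j\<in>?J. ?Q j) < \<infinity>"
        by (rule locally_finite_bounded[OF M]) (intro bounded_UN ballI bounded_grid_cube finite_neighbour_steps)
      then have "measure M (grid_cube p r k) \<le> measure M (\<Union>j\<in>?J. ?Q j)"
        using h M(1) by (intro measure_mono_fmeasurable) (auto simp: fmeasurable_def intro!: sets.finite_UN)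
      also have "\<dots> \<le> (\<Sum>j\<in>?J. measure M (?Q j))"
        using M(1) by (intro measure_UNION_le) auto
      finally have "real (card ?J) * measure M (grid_cube p r k) \<le> (\<Sum>j\<in>?J. real (card ?J) * measure M (?Q j))"
        by (simp add: mult_left_mono flip: sum_distrib_left)
      also have "\<dots> < (\<Sum>j\<in>?J. measure M (grid_cube p r k))"
        using less card_neighbour_steps_ge_1[where 'a = 'n] by (intro sum_strict_mono) auto
      finally show False by simp
    qed
  qed
qed


text \<open>
  Below the gap every exponent has a band with few cubes, whose radius may be taken as small as
  desired. Compactness of the interval leaves finitely many bands.
\<close>

lemma finite_band_cover:
  fixes M :: "(real ^ 'n) measure"
  assumes M: "sets M = sets borel" "locally_finite M" and "0 < \<delta>"
    and gap: "\<And>s. s \<in> {t..s0} \<Longrightarrow> ereal \<epsilon> < ereal (\<theta> * s) - coarse_spectrum M s"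
  obtains S e where "S \<subseteq> {t..s0}" "finite S" "{t..s0} \<subseteq> (\<Union>s\<in>S. ball s (e s / 2))"
    "\<forall>s\<in>S. 0 < e s \<and> e s \<le> \<delta>"
    "\<forall>s\<in>S. \<forall>\<^sub>F r in at_right 0. finite (level_band M s (e s) r) \<and>
       real (card (level_band M s (e s) r)) \<le> r powr (- (\<theta> * s - \<epsilon>))"
proof -
  define good where "good s e \<longleftrightarrow> 0 < e \<and> e \<le> \<delta> \<and> (\<forall>\<^sub>F r in at_right 0.
      finite (level_band M s e r) \<and> real (card (level_band M s e r)) \<le> r powr (- (\<theta> * s - \<epsilon>)))" for s e
  have "\<exists>e. good s e" if "s \<in> {t..s0}" for s
  proof -
    have "coarse_spectrum M s < ereal (\<theta> * s - \<epsilon>)"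
      using gap[OF that] by (cases "coarse_spectrum M s") auto
    then obtain e0 where "0 < e0" and e0: "\<And>e. 0 < e \<Longrightarrow> e \<le> e0 \<Longrightarrow> \<forall>\<^sub>F r in at_right 0.
        finite (level_band M s e r) \<and> real (card (level_band M s e r)) \<le> r powr (- (\<theta> * s - \<epsilon>))"
      using level_band_card_of_spectrum_less[OF M] by blast
    then have "good s (min e0 \<delta>)"
      unfolding good_def using \<open>0 < \<delta>\<close> by (intro conjI e0) auto
    then show ?thesis by blast
  qed
  then obtain e where e: "\<And>s. s \<in> {t..s0} \<Longrightarrow> good s (e s)" by metis
  have "{t..s0} \<subseteq> (\<Union>s\<in>{t..s0}. ball s (e s / 2))"
  proof
    fix s assume s: "s \<in> {t..s0}"
    then have "s \<in> ball s (e s / 2)" using e[OF s] by (simp add: good_def)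
    then show "s \<in> (\<Union>s\<in>{t..s0}. ball s (e s / 2))" using s by blast
  qed
  then obtain S where S: "S \<subseteq> {t..s0}" "finite S" "{t..s0} \<subseteq> (\<Union>s\<in>S. ball s (e s / 2))"
    by (rule compactE_image[OF compact_Icc open_ball])
  show thesis
    using e S(1) by (intro that[OF S]) (auto simp: good_def subset_iff)
qed

text \<open>
  Each heavy cube has a neighbour in the grid based at 0 that has comparable measure and lies in one of
  the bands. For fixed band and fixed neighbour step the assignment is injective, so at most
  \<open>r\<close> to the power \<open>-(\<theta> s - \<epsilon>)\<close> cubes occur, each contributing at most \<open>c\<close> times \<open>r\<close> to the power
  \<open>(s - e\<^sub>s) \<eta>\<close>. The resulting exponent is \<open>\<epsilon> - (\<theta> - \<eta>) s - e\<^sub>s \<eta>\<close>, and each of the two losses is at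
  most \<open>\<epsilon>/4\<close>.
\<close>

lemma heavy_region_net_content_at_scale:
  fixes M :: "(real ^ 'n) measure"
  defines "c \<equiv> real (card (neighbour_steps :: ('n \<Rightarrow> int) set))"
  assumes M: "sets M = sets borel" "locally_finite M"
    and \<eta>: "0 < \<eta>" "\<eta> < \<theta>" "\<theta> \<le> 1" and "t \<le> s0"
    and close: "(\<theta> - \<eta>) * s0 \<le> \<epsilon> / 4"
    and S: "S \<subseteq> {t..s0}" "finite S" "{t..s0} \<subseteq> (\<Union>s\<in>S. ball s (e s / 2))"
    and e: "\<And>s. s \<in> S \<Longrightarrow> 0 < e s \<and> e s \<le> \<epsilon> / 4"
    and r_def: "r = (1/2) ^ n" and "1 \<le> n"
    and band: "\<And>s. s \<in> S \<Longrightarrow> c * r powr (e s / 2) \<le> 1"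
      "\<And>s. s \<in> S \<Longrightarrow> finite (level_band M s (e s) r)"
      "\<And>s. s \<in> S \<Longrightarrow> real (card (level_band M s (e s) r)) \<le> r powr (- (\<theta> * s - \<epsilon>))"
    and dec: "\<And>k. measure M (grid_cube p r k) \<le> r powr t"
  shows "net_content p M \<eta> (heavy_region p M s0 r) \<le> ennreal (real (card S) * c * c * r powr (\<epsilon> / 2))"
proof -
  let ?J = "neighbour_steps :: ('n \<Rightarrow> int) set"
  have c: "1 \<le> c" unfolding c_def using card_neighbour_steps_ge_1 by simp
  have r: "0 < r" "r < 1" using \<open>1 \<le> n\<close> by (auto simp: r_def power_less_one_iff)
  obtain h where h: "\<And>k. \<exists>j\<in>?J. measure M (grid_cube p r k)
      \<le> c * measure M (grid_cube 0 r (\<lambda>i. k i + h i + j i))"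
    unfolding c_def using grid_measure_comparison[OF M r(1), of p 0] by blast
  \<comment> \<open>The comparison in the opposite direction carries the decay bound over to the grid based at 0.\<close>
  obtain h' where h': "\<And>k. \<exists>j\<in>?J. measure M (grid_cube 0 r k)
      \<le> c * measure M (grid_cube p r (\<lambda>i. k i + h' i + j i))"
    unfolding c_def using grid_measure_comparison[OF M r(1), of 0 p] by blast
  have dec0: "measure M (grid_cube 0 r k) \<le> c * r powr t" for k
  proof -
    obtain j where "measure M (grid_cube 0 r k) \<le> c * measure M (grid_cube p r (\<lambda>i. k i + h' i + j i))"
      using h' by blast
    also have "\<dots> \<le> c * r powr t" using c dec by (intro mult_left_mono) auto
    finally show ?thesis .
  qed
  define B where "B s j = {k. (\<lambda>i. k i + h i + j i) \<in> level_band M s (e s) r \<and>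
    measure M (grid_cube p r k) \<le> c * measure M (grid_cube 0 r (\<lambda>i. k i + h i + j i))}" for s j
  have heavy_sub: "heavy_region p M s0 r \<subseteq> (\<Union>s\<in>S. \<Union>j\<in>?J. \<Union>k\<in>B s j. grid_cube p r k)"
  proof
    fix x assume "x \<in> heavy_region p M s0 r"
    then obtain k where k: "r powr s0 < measure M (grid_cube p r k)" "x \<in> grid_cube p r k"
      unfolding heavy_region_def by blast
    obtain j where j: "j \<in> ?J" "measure M (grid_cube p r k)
        \<le> c * measure M (grid_cube 0 r (\<lambda>i. k i + h i + j i))" using h by blast
    have "\<exists>s\<in>S. r powr (s + e s) \<le> measure M (grid_cube 0 r (\<lambda>i. k i + h i + j i)) \<and>
        measure M (grid_cube 0 r (\<lambda>i. k i + h i + j i)) < r powr (s - e s)"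
      using k(1) j(2) by (intro exists_level_band[OF r c \<open>t \<le> s0\<close> _ dec0 S(3) band(1)]) auto
    then obtain s where "s \<in> S" "(\<lambda>i. k i + h i + j i) \<in> level_band M s (e s) r"
      unfolding level_band_def by blast
    then have "k \<in> B s j" using j(2) by (simp add: B_def)
    then show "x \<in> (\<Union>s\<in>S. \<Union>j\<in>?J. \<Union>k\<in>B s j. grid_cube p r k)"
      using \<open>s \<in> S\<close> j(1) k(2) by blast
  qed
  have inj: "inj_on (\<lambda>k i. k i + h i + j i) A" for j A
    by (auto simp: inj_on_def fun_eq_iff)
  have B_img: "(\<lambda>k i. k i + h i + j i) ` B s j \<subseteq> level_band M s (e s) r" for s j
    by (auto simp: B_def)
  have B_fin: "finite (B s j)" if "s \<in> S" for s j
    using finite_subset[OF B_img band(2)[OF that]] inj by (rule finite_imageD)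
  have B_card: "real (card (B s j)) \<le> r powr (- (\<theta> * s - \<epsilon>))" if "s \<in> S" for s j
    using card_inj_on_le[OF inj B_img band(2)[OF that]] band(3)[OF that] by (meson of_nat_mono order_trans)
  have one: "net_content p M \<eta> (\<Union>k\<in>B s j. grid_cube p r k) \<le> ennreal (c * r powr (\<epsilon> / 2))"
    if s: "s \<in> S" for s j
  proof -
    have st: "s \<le> s0" "0 < e s" "e s \<le> \<epsilon> / 4" using S(1) s e by auto
    have each: "net_content p M \<eta> (grid_cube p r k) \<le> ennreal (c * r powr ((s - e s) * \<eta>))"
      if k: "k \<in> B s j" for k
    proof -
      have "measure M (grid_cube p r k) \<le> c * r powr (s - e s)"
        using k c by (auto simp: B_def level_band_def intro: order_trans[OF _ mult_left_mono])
      then have "measure M (grid_cube p r k) powr \<eta> \<le> (c * r powr (s - e s)) powr \<eta>"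
        using \<eta> by (intro powr_mono2) auto
      also have "\<dots> = c powr \<eta> * r powr ((s - e s) * \<eta>)"
        using c by (simp add: powr_mult powr_powr)
      also have "\<dots> \<le> c * r powr ((s - e s) * \<eta>)"
        using powr_mono[of \<eta> 1 c] c \<eta> by (intro mult_right_mono) auto
      finally have "ennreal (measure M (grid_cube p r k) powr \<eta>) \<le> ennreal (c * r powr ((s - e s) * \<eta>))"
        by (rule ennreal_leI)
      moreover have "grid_cube p r k \<in> dyadic p" unfolding r_def by (rule grid_cube_dyadic)
      ultimately show ?thesis using net_content_dyadic_le order_trans by blast
    qed
    have "net_content p M \<eta> (\<Union>k\<in>B s j. grid_cube p r k) \<le> (\<Sum>k\<in>B s j. net_content p M \<eta> (grid_cube p r k))"
      by (rule net_content_finite_UN_le[OF B_fin[OF s]])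
    also have "\<dots> \<le> (\<Sum>k\<in>B s j. ennreal (c * r powr ((s - e s) * \<eta>)))"
      by (intro sum_mono each)
    also have "\<dots> = ennreal (real (card (B s j)) * (c * r powr ((s - e s) * \<eta>)))"
      by (simp add: ennreal_mult'' ennreal_of_nat_eq_real_of_nat c_def)
    also have "\<dots> \<le> ennreal (r powr (- (\<theta> * s - \<epsilon>)) * (c * r powr ((s - e s) * \<eta>)))"
      using B_card[OF s] c by (intro ennreal_leI mult_right_mono) auto
    also have "r powr (- (\<theta> * s - \<epsilon>)) * (c * r powr ((s - e s) * \<eta>))
        = c * r powr (- (\<theta> * s - \<epsilon>) + (s - e s) * \<eta>)"
      by (simp only: powr_add mult_ac)
    also have "ennreal \<dots> \<le> ennreal (c * r powr (\<epsilon> / 2))"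
    proof (intro ennreal_leI mult_left_mono powr_mono')
      have "(\<theta> - \<eta>) * s \<le> (\<theta> - \<eta>) * s0" using st(1) \<eta> by (intro mult_left_mono) auto
      moreover have "e s * \<eta> \<le> e s * 1" using st(2) \<eta> by (intro mult_left_mono) auto
      ultimately show "\<epsilon> / 2 \<le> - (\<theta> * s - \<epsilon>) + (s - e s) * \<eta>"
        using close st(3) by (simp add: algebra_simps)
    qed (use c r in auto)
    finally show ?thesis .
  qed
  have "net_content p M \<eta> (heavy_region p M s0 r)
      \<le> net_content p M \<eta> (\<Union>s\<in>S. \<Union>j\<in>?J. \<Union>k\<in>B s j. grid_cube p r k)"
    by (rule net_content_mono[OF heavy_sub])
  also have "\<dots> \<le> (\<Sum>s\<in>S. net_content p M \<eta> (\<Union>j\<in>?J. \<Union>k\<in>B s j. grid_cube p r k))"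
    by (rule net_content_finite_UN_le[OF S(2)])
  also have "\<dots> \<le> (\<Sum>s\<in>S. \<Sum>j\<in>?J. net_content p M \<eta> (\<Union>k\<in>B s j. grid_cube p r k))"
    by (intro sum_mono net_content_finite_UN_le) simp
  also have "\<dots> \<le> (\<Sum>s\<in>S. \<Sum>j\<in>?J. ennreal (c * r powr (\<epsilon> / 2)))"
    by (intro sum_mono one)
  also have "\<dots> = ennreal (real (card S) * c * c * r powr (\<epsilon> / 2))"
    by (simp add: ennreal_mult'' ennreal_of_nat_eq_real_of_nat c_def mult.assoc)
  finally show ?thesis .
qed

text \<open>
  As \<open>r\<close> tends to 0, the finitely many conditions on \<open>r\<close> in the estimate at a fixed scale are
  eventually satisfied, with constants that do not depend on the scale.
\<close>

lemma heavy_region_net_content_le: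
  fixes M :: "(real ^ 'n) measure"
  assumes M: "sets M = sets borel" "locally_finite M"
    and \<eta>: "0 < \<eta>" "\<eta> < \<theta>" "\<theta> \<le> 1" and "t \<le> s0" and \<epsilon>: "0 < \<epsilon>"
    and gap: "\<And>s. s \<in> {t..s0} \<Longrightarrow> ereal \<epsilon> < ereal (\<theta> * s) - coarse_spectrum M s"
    and close: "(\<theta> - \<eta>) * s0 \<le> \<epsilon> / 4"
    and decay: "\<forall>\<^sub>F n in sequentially. \<forall>k. measure M (grid_cube p ((1/2) ^ n) k) \<le> ((1/2) ^ n) powr t"
  obtains C where "0 \<le> C" "\<forall>\<^sub>F n in sequentially.
    net_content p M \<eta> (heavy_region p M s0 ((1/2) ^ n)) \<le> ennreal (C * ((1/2) ^ n) powr (\<epsilon> / 2))"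
proof -
  define c where "c = real (card (neighbour_steps :: ('n \<Rightarrow> int) set))"
  have c: "1 \<le> c" unfolding c_def using card_neighbour_steps_ge_1 by simp
  have "0 < \<epsilon> / 4" using \<epsilon> by simp
  then obtain S e
    where S: "S \<subseteq> {t..s0}" "finite S" "{t..s0} \<subseteq> (\<Union>s\<in>S. ball s (e s / 2))"
      and e: "\<forall>s\<in>S. 0 < e s \<and> e s \<le> \<epsilon> / 4"
      and card: "\<forall>s\<in>S. \<forall>\<^sub>F r in at_right 0. finite (level_band M s (e s) r) \<and>
        real (card (level_band M s (e s) r)) \<le> r powr (- (\<theta> * s - \<epsilon>))"
    by (rule finite_band_cover[OF M _ gap])
  have small: "\<forall>\<^sub>F r in at_right 0. c * r powr (e s / 2) \<le> 1" if "s \<in> S" for s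
  proof -
    have es: "0 < e s / 2" using e that by simp
    have "((\<lambda>r. r powr (e s / 2)) \<longlongrightarrow> 0) (at_right 0)"
      by (rule tendsto_zero_powrI[OF tendsto_ident_at tendsto_const _ es])
        (auto intro: eventually_mono[OF eventually_at_right_less])
    then have "((\<lambda>r. c * r powr (e s / 2)) \<longlongrightarrow> c * 0) (at_right 0)"
      by (rule tendsto_mult_left)
    then have "\<forall>\<^sub>F r in at_right 0. c * r powr (e s / 2) < 1"
      by (rule order_tendstoD) simp
    then show ?thesis by eventually_elim simp
  qed
  have "\<forall>\<^sub>F r in at_right 0. \<forall>s\<in>S. c * r powr (e s / 2) \<le> 1 \<and> finite (level_band M s (e s) r) \<and>
      real (card (level_band M s (e s) r)) \<le> r powr (- (\<theta> * s - \<epsilon>))"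
    by (intro eventually_ball_finite[OF S(2)] ballI eventually_conj small card[rule_format])
  moreover have "filterlim (\<lambda>n. (1/2::real) ^ n) (at_right 0) sequentially"
    by (intro tendsto_imp_filterlim_at_right LIMSEQ_power_zero) auto
  ultimately have "\<forall>\<^sub>F n in sequentially. \<forall>s\<in>S. c * ((1/2) ^ n) powr (e s / 2) \<le> 1 \<and>
      finite (level_band M s (e s) ((1/2) ^ n)) \<and>
      real (card (level_band M s (e s) ((1/2) ^ n))) \<le> ((1/2) ^ n) powr (- (\<theta> * s - \<epsilon>))"
    by (rule eventually_compose_filterlim)
  then have "\<forall>\<^sub>F n in sequentially.
    net_content p M \<eta> (heavy_region p M s0 ((1/2) ^ n))
      \<le> ennreal (real (card S) * c * c * ((1/2) ^ n) powr (\<epsilon> / 2))"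
    using decay eventually_ge_at_top[of 1]
  proof eventually_elim
    case (elim n)
    show ?case
      unfolding c_def
      by (rule heavy_region_net_content_at_scale[OF M \<eta> \<open>t \<le> s0\<close> close S e[rule_format] refl elim(3)])
        (use elim(1,2) in \<open>auto simp: c_def\<close>)
  qed
  then show thesis using c by (intro that[of "real (card S) * c * c"]) auto
qed

section \<open>Dimension of sets with large intersections\<close>

text \<open>
  Geometric decay of the heavy content is only asked for \<open>\<eta>\<close> close to \<open>\<theta>\<close>: a spectral gap of size
  \<open>\<epsilon>\<close> tolerates only a small difference \<open>\<theta> - \<eta>\<close>.
\<close>

lemma hausdorff_dim_ge_of_heavy_decay:
  fixes M :: "(real ^ 'n) measure"
  assumes M: "sets M = sets borel" "locally_finite M"
    and \<theta>: "0 < \<theta>" "\<theta> \<le> 1" and E: "E \<in> large_intersection p M \<theta>"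
    and D: "D \<in> dyadic p" "0 < emeasure M D"
    and pos: "0 < \<sigma>" "0 < \<delta>" and "\<eta>0 < \<theta>"
    and heavy: "\<And>\<eta>. 0 < \<eta> \<Longrightarrow> \<eta>0 < \<eta> \<Longrightarrow> \<eta> < \<theta> \<Longrightarrow> \<exists>C\<ge>0. \<forall>\<^sub>F n in sequentially.
      net_content p M \<eta> (heavy_region p M \<sigma> ((1/2) ^ n)) \<le> ennreal (C * ((1/2) ^ n) powr \<delta>)"
  shows "ereal (\<theta> * \<sigma>) \<le> hausdorff_dim (E \<inter> D)"
proof (rule hausdorff_dim_geI)
  fix y assume "y < \<theta> * \<sigma>"
  then have lt: "max (max 0 \<eta>0) (y / \<sigma>) < \<theta>"
    using \<theta>(1) pos(1) \<open>\<eta>0 < \<theta>\<close> by (simp add: pos_divide_less_eq)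
  obtain \<eta> where \<eta>: "0 < \<eta>" "\<eta>0 < \<eta>" "y / \<sigma> < \<eta>" "\<eta> < \<theta>"
    using dense[OF lt] by auto
  obtain C where C: "0 \<le> C" "\<forall>\<^sub>F n in sequentially.
      net_content p M \<eta> (heavy_region p M \<sigma> ((1/2) ^ n)) \<le> ennreal (C * ((1/2) ^ n) powr \<delta>)"
    using heavy[OF \<eta>(1,2,4)] by blast
  then obtain N0 where N0: "\<And>n. n \<ge> N0 \<Longrightarrow>
      net_content p M \<eta> (heavy_region p M \<sigma> ((1/2) ^ n)) \<le> ennreal (C * ((1/2) ^ n) powr \<delta>)"
    by (auto simp: eventually_sequentially)
  obtain r k where Dk: "D = grid_cube p r k" using D(1) by (rule dyadicE)
  have "0 < measure M D"
    using D(2) unfolding Dk emeasure_grid_cube[OF M] by simp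
  then have w: "0 < measure M D powr \<eta>" by simp
  have "ennreal (measure M D powr \<eta>) \<le> net_content p M \<eta> D"
    using \<eta> \<theta> unfolding Dk
    by (intro net_content_ge_measure_powr[OF M] locally_finite_bounded[OF M] bounded_grid_cube grid_cube_borel) auto
  also have "\<dots> = net_content p M \<eta> (E \<inter> D)"
    using E D(1) \<eta> by (simp add: large_intersection_def)
  finally have content: "ennreal (measure M D powr \<eta>) \<le> net_content p M \<eta> (E \<inter> D)" .
  have "summable (\<lambda>n. C * ((1/2) powr \<delta>) ^ n)"
    using powr_less_mono'[of "1/2" 0 \<delta>] pos(2) by (intro summable_mult summable_geometric) auto
  then have "summable (\<lambda>n. C * ((1/2) ^ n) powr \<delta>)"
    by (simp add: powr_power powr_powr mult.commute flip: powr_realpow)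
  then have "hausdorff_measure (\<sigma> * \<eta>) (E \<inter> D) \<noteq> 0"
    using C(1) by (intro hausdorff_measure_nonzero[OF w content pos(1) \<eta>(1) N0]) auto
  moreover have "y < \<sigma> * \<eta>" using \<eta>(3) pos(1) by (simp add: pos_divide_less_eq mult.commute)
  ultimately show "\<exists>u>y. hausdorff_measure u (E \<inter> D) \<noteq> 0" by blast
qed

theorem theorem2p5:
  fixes P :: "real ^ 'n" and \<mu> :: "(real ^ 'n) measure"
    and E D :: "(real ^ 'n) set" and \<theta> t :: real and n0 :: int
  assumes "sets \<mu> = sets borel" and "nonatomic \<mu>" and "locally_finite \<mu>"
    and "dyadic_boundaries P \<in> null_sets \<mu>"
    and "0 < \<theta>" and "\<theta> \<le> 1" and "E \<in> large_intersection P \<mu> \<theta>"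
    and "0 < t"
    and "\<And>n D'. n \<ge> n0 \<Longrightarrow> D' \<in> dyadic_level P n
           \<Longrightarrow> emeasure \<mu> D' \<le> ennreal (2 powr (- t * of_int n))"
    and "D \<in> dyadic P" and "emeasure \<mu> D > 0"
  shows "hausdorff_dim (E \<inter> D) \<ge> ereal (\<theta> * t)
    \<and> hausdorff_dim (E \<inter> D) \<ge> ereal \<theta> *
        (SUP s0\<in>{s0 :: real. \<exists>\<epsilon>>0. \<forall>s\<in>{t..s0}. ereal (\<theta> * s) - coarse_spectrum \<mu> s > ereal \<epsilon>}. ereal s0)"
proof -
  note M = assms(1,3)
  have decay: "\<forall>\<^sub>F n in sequentially. \<forall>k. measure \<mu> (grid_cube P ((1/2) ^ n) k) \<le> ((1/2) ^ n) powr t"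
    using eventually_ge_at_top[of "nat n0"]
  proof eventually_elim
    case (elim n)
    show ?case
    proof
      fix k
      let ?Q = "grid_cube P ((1/2) ^ n) k"
      have "emeasure \<mu> ?Q \<le> ennreal (2 powr (- t * of_int (int n)))"
        using elim by (intro assms(9)) (auto simp: dyadic_level_nat)
      then have "measure \<mu> ?Q \<le> 2 powr (- t * of_int (int n))"
        unfolding emeasure_grid_cube[OF M] by (simp add: ennreal_le_iff2)
      also have "\<dots> = (2 powr (- real n)) powr t"
        by (simp add: powr_powr mult.commute)
      also have "2 powr (- real n) = (1/2) ^ n"
        by (simp add: powr_minus powr_realpow power_one_over inverse_eq_divide)
      finally show "measure \<mu> ?Q \<le> ((1/2) ^ n) powr t" .
    qed
  qed
  have first: "ereal (\<theta> * t) \<le> hausdorff_dim (E \<inter> D)"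
  proof (rule hausdorff_dim_ge_of_heavy_decay[OF M assms(5-7,10,11,8) zero_less_one assms(5)])
    fix \<eta>
    have "\<forall>\<^sub>F n in sequentially. net_content P \<mu> \<eta> (heavy_region P \<mu> t ((1/2) ^ n)) \<le> ennreal (0 * ((1/2) ^ n) powr 1)"
      using decay
    proof eventually_elim
      case (elim n)
      then have "heavy_region P \<mu> t ((1/2) ^ n) = {}" unfolding heavy_region_def using leD by blast
      then show ?case by simp
    qed
    then show "\<exists>C\<ge>0. \<forall>\<^sub>F n in sequentially.
        net_content P \<mu> \<eta> (heavy_region P \<mu> t ((1/2) ^ n)) \<le> ennreal (C * ((1/2) ^ n) powr 1)"
      by blast
  qed
  have second: "ereal (\<theta> * s0) \<le> hausdorff_dim (E \<inter> D)"
    if \<epsilon>: "0 < \<epsilon>" and gap: "\<forall>s\<in>{t..s0}. ereal (\<theta> * s) - coarse_spectrum \<mu> s > ereal \<epsilon>" for s0 \<epsilon>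
  \<comment> \<open>For \<open>s0 < t\<close> the gap condition is vacuous and the claim follows from the first bound.\<close>
  proof (cases "s0 < t")
    case True
    then have "ereal (\<theta> * s0) \<le> ereal (\<theta> * t)" using assms(5) by simp
    then show ?thesis using first by (rule order_trans)
  next
    case False
    then have s0: "t \<le> s0" "0 < s0" using assms(8) by auto
    show ?thesis
    proof (rule hausdorff_dim_ge_of_heavy_decay[OF M assms(5-7,10,11) s0(2), of "\<epsilon> / 2" "\<theta> - \<epsilon> / (4 * s0)"])
      fix \<eta> assume \<eta>: "0 < \<eta>" "\<theta> - \<epsilon> / (4 * s0) < \<eta>" "\<eta> < \<theta>"
      have "(\<theta> - \<eta>) * s0 \<le> \<epsilon> / (4 * s0) * s0"
        using \<eta>(2) s0(2) by (intro mult_right_mono) auto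
      then have close: "(\<theta> - \<eta>) * s0 \<le> \<epsilon> / 4" using s0(2) by simp
      show "\<exists>C\<ge>0. \<forall>\<^sub>F n in sequentially. net_content P \<mu> \<eta> (heavy_region P \<mu> s0 ((1/2) ^ n))
          \<le> ennreal (C * ((1/2) ^ n) powr (\<epsilon> / 2))"
        using heavy_region_net_content_le[OF M \<eta>(1,3) assms(6) s0(1) \<epsilon> gap[rule_format] close decay]
        by blast
    qed (use \<epsilon> s0(2) in auto)
  qed
  have "(SUP s0\<in>{s0 :: real. \<exists>\<epsilon>>0. \<forall>s\<in>{t..s0}. ereal (\<theta> * s) - coarse_spectrum \<mu> s > ereal \<epsilon>}. ereal s0)
      \<le> hausdorff_dim (E \<inter> D) / ereal \<theta>"
    using second assms(5) by (intro SUP_least) (auto simp: ereal_le_divide_pos)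
  then show ?thesis using first assms(5) by (simp add: ereal_le_divide_pos)
qed

end
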